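(* Let $P$ be a linear lasso program over $K^n$ in the normal form below, let $T$ be a linear ranking function template written in conjunctive normal form as below, and let $L$ be a finite index set with strictness symbols $\rhd_\ell\in\{\ge,>\}$ for $\ell\in L$. If the constraint $(\mathrm{II0})\wedge(\mathrm{IC0})\wedge(\mathrm{TI0})$ is satisfiable, then so is the constraint $(\mathrm{II5})\wedge(\mathrm{IC5})\wedge(\mathrm{TI5})$ (both defined below).
   Context: $K$ is $\mathbb{Q}$ or a real closed field; vectors are column vectors, $v^T$ is the transpose, $(x;x')\in K^{2n}$ is the stacked vector, vector inequalities are componentwise. A lasso program over $K^n$ is a pair $P=(\mathrm{stem},\mathrm{loop})$, $\mathrm{stem}\subseteq K^n$, $\mathrm{loop}\subseteq K^n\times K^n$; an execution is a finite or infinite sequence $\sigma_0\sigma_1\ldots$ with $\sigma_0\in\mathrm{stem}$ and $(\sigma_i,\sigma_{i+1})\in\mathrm{loop}$; $P$ terminates iff it has no infinite execution. $P$ is given in normal form: $\mathrm{stem}(x)\equiv\bigvee_{\nu\in N}(B_\nu x\le b_\nu\wedge B'_\nu x<b'_\nu)$, $\mathrm{loop}(x,x')\equiv\bigvee_{m\in M}(A_m(x;x')\le c_m\wedge A'_m(x;x')<c'_m)$, finite $N,M$, constant matrices/vectors over $K$. Templates: a template is a quantifier-free formula $T(x,x')$ that additionally contains a finite set $D$ of unknown scalars and a finite set $F$ of affine-linear function symbols, each $f\in F$ standing for $x\mapsto s_f^Tx+t_f$ with unknowns $s_f\in K^n,t_f\in K$. $T$ is a ranking function template iff for every lasso program $Q$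 over $K^n$, if some assignment to the unknowns makes $\forall\sigma,\sigma'.\ (\sigma,\sigma')\in\mathrm{loop}_Q\to T(\sigma,\sigma')$ true, then $Q$ terminates; it is linear if moreover it is a boolean combination of atoms $\sum_{f\in F}(\alpha_f f(x)+\beta_f f(x'))+\sum_{d\in D}\gamma_d d\rhd 0$ with constants $\alpha_f,\beta_f,\gamma_d\in K$, $\rhd\in\{\ge,>\}$. Here $T\equiv\bigwedge_{i\in I}\bigvee_{j\in J_i}T_{i,j}(x,x')$ (CNF), each atom occurrence written as $d_{i,j}^T(x;x')\rhd_{i,j}e_{i,j}$ with $d_{i,j}=(\sum_f\alpha_f s_f;\sum_f\beta_f s_f)$, $e_{i,j}=-(\sum_f(\alpha_f+\beta_f)t_f+\sum_d\gamma_d d)$. Original constraint: for $\ell\in L$ let $\psi_\ell(x)\equiv s_\ell^Tx+t_\ell\rhd_\ell0$ with unknowns $s_\ell\in K^n,t_\ell\in K$. (II0) is $\bigwedge_{\ell\in L}\forall x.\ \mathrm{stem}(x)\to\psi_\ell(x)$; (IC0) is $\bigwedge_{\ell\in L}\forall x,x'.\ \psi_\ell(x)\wedge\mathrm{loop}(x,x')\to\psi_\ell(x')$; (TI0) is $\forall x,x'.\ \mathrm{loop}(x,x')\wedge\bigwedge_{\ell\in L}\psi_\ell(x)\to T(x,x')$. Transformed constraint: let $L'=L\times I\times M$; for $\ell'=(\ell,i,m)\in L'$ introduce fresh unknowns $s_{\ell'}\in K^n,t_{\ell'}\in K$ and $\psi_{\ell'}(x)\equiv s_{\ell'}^Tx+t_{\ell'}\rhd_\ell0$.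 Read $\neg(a\ge b)$ as $a<b$ and $\neg(a>b)$ as $a\le b$. Consider (II4) for $\ell'\in L'$, $\nu\in N$: $\forall x.\ \neg(B_\nu x\le b_\nu\wedge B'_\nu x<b'_\nu\wedge\neg\psi_{\ell'}(x))$; (IC4) for $\ell'\in L'$, $m\in M$: $\forall x,x'.\ \neg(\psi_{\ell'}(x)\wedge A_m(x;x')\le c_m\wedge A'_m(x;x')<c'_m\wedge\neg\psi_{\ell'}(x'))$; (TI4) for $i\in I$, $m\in M$: $\forall x,x'.\ \neg\big(A_m(x;x')\le c_m\wedge A'_m(x;x')<c'_m\wedge\bigwedge_{\ell\in L}\psi_{(\ell,i,m)}(x)\wedge\bigwedge_{j\in J_i}\neg T_{i,j}(x,x')\big)$. In each, with $z$ the quantified vector, write every conjunct inside $\neg(\ldots)$ (matrix rows separately) as $p_k^Tz\le q_k$ ($k\in R_\le$) or $p_k^Tz<q_k$ ($k\in R_<$) by collecting $z$-terms on the left, without rescaling. Its Motzkin transform is $\exists(\kappa_k)_k\ge0.\ \sum_k\kappa_kp_k=0\wedge\sum_k\kappa_kq_k\le0\wedge(\sum_{k\in R_\le}\kappa_kq_k<0\vee\sum_{k\in R_<}\kappa_k>0)$. (II5), (IC5), (TI5) are the conjunctions of the Motzkin transforms (fresh coefficients each) of all formulas in (II4), (IC4), (TI4). A constraint is satisfiable iff some values in $K$ for all its unknowns (invariant coefficients, template coefficients $s_f,t_f$, and $d\in D$) make it true in $K$. *)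

theory Defs
  imports "Jordan_Normal_Form.Matrix" "HOL-Computational_Algebra.Polynomial"
begin

definition real_closed :: "'a::linordered_field itself \<Rightarrow> bool" where
  "real_closed _ \<longleftrightarrow>
     (\<forall>x::'a. 0 \<le> x \<longrightarrow> (\<exists>y. y ^ 2 = x)) \<and>
     (\<forall>p::'a poly. odd (degree p) \<longrightarrow> (\<exists>x. poly p x = 0))"

text \<open>An ordered field has characteristic 0, and its prime field is \<open>\<rat>\<close> with the usual order.\<close>

definition rational_or_real_closed :: "'a::linordered_field itself \<Rightarrow> bool" where
  "rational_or_real_closed ty \<longleftrightarrow> (UNIV :: 'a set) = \<rat> \<or> real_closed ty"


subsection \<open>Lasso programs\<close>

type_synonym 'a lasso = "'a vec set \<times> ('a vec \<times> 'a vec) set"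

definition lasso_program :: "nat \<Rightarrow> 'a lasso \<Rightarrow> bool" where
  "lasso_program n Q \<longleftrightarrow>
     fst Q \<subseteq> carrier_vec n \<and> snd Q \<subseteq> carrier_vec n \<times> carrier_vec n"

definition infinite_execution :: "'a lasso \<Rightarrow> (nat \<Rightarrow> 'a vec) \<Rightarrow> bool" where
  "infinite_execution Q \<sigma> \<longleftrightarrow> \<sigma> 0 \<in> fst Q \<and> (\<forall>i. (\<sigma> i, \<sigma> (Suc i)) \<in> snd Q)"

definition terminates :: "'a lasso \<Rightarrow> bool" where
  "terminates Q \<longleftrightarrow> (\<nexists>\<sigma>. infinite_execution Q \<sigma>)"


subsection \<open>Linear lasso programs in normal form\<close>

text \<open>The conjunction \<open>A z \<le> c \<and> A' z < c'\<close>.\<close>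

record 'a lin_conj =
  weak_mat :: "'a mat"
  weak_rhs :: "'a vec"
  strict_mat :: "'a mat"
  strict_rhs :: "'a vec"

definition wf_conj :: "nat \<Rightarrow> 'a lin_conj \<Rightarrow> bool" where
  "wf_conj d C \<longleftrightarrow>
     weak_mat C \<in> carrier_mat (dim_vec (weak_rhs C)) d \<and>
     strict_mat C \<in> carrier_mat (dim_vec (strict_rhs C)) d"

text \<open>The library's \<open><\<close> on vectors is the strict part of the componentwise \<open>\<le>\<close>, not the
  componentwise strict inequality.\<close>

definition vec_lt :: "'a::ord vec \<Rightarrow> 'a vec \<Rightarrow> bool" where
  "vec_lt v w \<longleftrightarrow> dim_vec v = dim_vec w \<and> (\<forall>i<dim_vec w. v $ i < w $ i)"

definition conj_holds :: "'a::linordered_field lin_conj \<Rightarrow> 'a vec \<Rightarrow> bool" where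
  "conj_holds C z \<longleftrightarrow>
     weak_mat C *\<^sub>v z \<le> weak_rhs C \<and> vec_lt (strict_mat C *\<^sub>v z) (strict_rhs C)"

record ('\<nu>, 'm, 'a) lasso_nf =
  stem_index :: "'\<nu> set"
  stem_conj :: "'\<nu> \<Rightarrow> 'a lin_conj"
  loop_index :: "'m set"
  loop_conj :: "'m \<Rightarrow> 'a lin_conj"

definition wf_lasso_nf :: "nat \<Rightarrow> ('\<nu>, 'm, 'a) lasso_nf \<Rightarrow> bool" where
  "wf_lasso_nf n P \<longleftrightarrow>
     finite (stem_index P) \<and> (\<forall>\<nu>\<in>stem_index P. wf_conj n (stem_conj P \<nu>)) \<and>
     finite (loop_index P) \<and> (\<forall>m\<in>loop_index P. wf_conj (n + n) (loop_conj P m))"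

definition stem_of :: "nat \<Rightarrow> ('\<nu>, 'm, 'a::linordered_field) lasso_nf \<Rightarrow> 'a vec set" where
  "stem_of n P = {x \<in> carrier_vec n. \<exists>\<nu>\<in>stem_index P. conj_holds (stem_conj P \<nu>) x}"

definition loop_of ::
  "nat \<Rightarrow> ('\<nu>, 'm, 'a::linordered_field) lasso_nf \<Rightarrow> ('a vec \<times> 'a vec) set" where
  "loop_of n P = {(x, x'). x \<in> carrier_vec n \<and> x' \<in> carrier_vec n \<and>
     (\<exists>m\<in>loop_index P. conj_holds (loop_conj P m) (x @\<^sub>v x'))}"


subsection \<open>Templates\<close>

datatype strictness = GE | GT

fun cmp_zero :: "'a::linordered_field \<Rightarrow> strictness \<Rightarrow> bool" where
  "cmp_zero a GE \<longleftrightarrow> a \<ge> 0"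
| "cmp_zero a GT \<longleftrightarrow> a > 0"

text \<open>A template is given semantically: \<open>V\<close> is the set of assignments to its unknowns, and
  \<open>T v x x'\<close> is its truth value under the assignment \<open>v\<close>.\<close>

definition ranking_function_template ::
  "nat \<Rightarrow> 'v set \<Rightarrow> ('v \<Rightarrow> 'a vec \<Rightarrow> 'a vec \<Rightarrow> bool) \<Rightarrow> bool" where
  "ranking_function_template n V T \<longleftrightarrow>
     (\<forall>Q. lasso_program n Q \<longrightarrow>
        (\<exists>v\<in>V. \<forall>\<sigma> \<sigma>'. (\<sigma>, \<sigma>') \<in> snd Q \<longrightarrow> T v \<sigma> \<sigma>') \<longrightarrow> terminates Q)"

record ('f, 'd, 'a) atom =
  coeff_pre :: "'f \<Rightarrow> 'a"   (* the \<alpha>_f *)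
  coeff_post :: "'f \<Rightarrow> 'a"  (* the \<beta>_f *)
  coeff_var :: "'d \<Rightarrow> 'a"   (* the \<gamma>_d *)
  atom_rel :: strictness

record ('f, 'd, 'i, 'j, 'a) cnf_template =
  fun_syms :: "'f set"
  var_syms :: "'d set"
  clauses :: "'i set"
  disjuncts :: "'i \<Rightarrow> 'j set"
  atom_at :: "'i \<Rightarrow> 'j \<Rightarrow> ('f, 'd, 'a) atom"

definition wf_template :: "('f, 'd, 'i, 'j, 'a) cnf_template \<Rightarrow> bool" where
  "wf_template T \<longleftrightarrow> finite (fun_syms T) \<and> finite (var_syms T) \<and>
     finite (clauses T) \<and> (\<forall>i\<in>clauses T. finite (disjuncts T i))"

record ('f, 'd, 'a) assignment =
  fun_lin :: "'f \<Rightarrow> 'a vec"  (* the s_f *)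
  fun_const :: "'f \<Rightarrow> 'a"    (* the t_f *)
  var_val :: "'d \<Rightarrow> 'a"

definition assignments ::
  "nat \<Rightarrow> ('f, 'd, 'i, 'j, 'a) cnf_template \<Rightarrow> ('f, 'd, 'a) assignment set" where
  "assignments n T = {v. \<forall>f\<in>fun_syms T. fun_lin v f \<in> carrier_vec n}"

definition fun_val :: "('f, 'd, 'a::linordered_field) assignment \<Rightarrow> 'f \<Rightarrow> 'a vec \<Rightarrow> 'a" where
  "fun_val v f x = fun_lin v f \<bullet> x + fun_const v f"

definition atom_holds ::
  "('f, 'd, 'i, 'j, 'a::linordered_field) cnf_template \<Rightarrow> ('f, 'd, 'a) assignment \<Rightarrow>
     ('f, 'd, 'a) atom \<Rightarrow> 'a vec \<Rightarrow> 'a vec \<Rightarrow> bool" where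
  "atom_holds T v g x x' \<longleftrightarrow>
     cmp_zero ((\<Sum>f\<in>fun_syms T. coeff_pre g f * fun_val v f x + coeff_post g f * fun_val v f x')
               + (\<Sum>d\<in>var_syms T. coeff_var g d * var_val v d))
       (atom_rel g)"

definition template_holds ::
  "('f, 'd, 'i, 'j, 'a::linordered_field) cnf_template \<Rightarrow> ('f, 'd, 'a) assignment \<Rightarrow>
     'a vec \<Rightarrow> 'a vec \<Rightarrow> bool" where
  "template_holds T v x x' \<longleftrightarrow>
     (\<forall>i\<in>clauses T. \<exists>j\<in>disjuncts T i. atom_holds T v (atom_at T i j) x x')"

definition linear_ranking_template ::
  "nat \<Rightarrow> ('f, 'd, 'i, 'j, 'a::linordered_field) cnf_template \<Rightarrow> bool" where
  "linear_ranking_template n T \<longleftrightarrow>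
     wf_template T \<and> ranking_function_template n (assignments n T) (template_holds T)"

text \<open>The vector \<open>d\<close> and scalar \<open>e\<close> for which the atom reads \<open>d\<^sup>T (x; x') \<rhd> e\<close>.\<close>

definition atom_vec ::
  "nat \<Rightarrow> ('f, 'd, 'i, 'j, 'a::linordered_field) cnf_template \<Rightarrow> ('f, 'd, 'a) assignment \<Rightarrow>
     ('f, 'd, 'a) atom \<Rightarrow> 'a vec" where
  "atom_vec n T v g =
     finsum_vec TYPE('a) n (\<lambda>f. coeff_pre g f \<cdot>\<^sub>v fun_lin v f) (fun_syms T) @\<^sub>v
     finsum_vec TYPE('a) n (\<lambda>f. coeff_post g f \<cdot>\<^sub>v fun_lin v f) (fun_syms T)"

definition atom_scalar ::
  "('f, 'd, 'i, 'j, 'a::linordered_field) cnf_template \<Rightarrow> ('f, 'd, 'a) assignment \<Rightarrow>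
     ('f, 'd, 'a) atom \<Rightarrow> 'a" where
  "atom_scalar T v g =
     - ((\<Sum>f\<in>fun_syms T. (coeff_pre g f + coeff_post g f) * fun_const v f)
        + (\<Sum>d\<in>var_syms T. coeff_var g d * var_val v d))"


subsection \<open>The original constraint\<close>

definition psi :: "'a::linordered_field vec \<Rightarrow> 'a \<Rightarrow> strictness \<Rightarrow> 'a vec \<Rightarrow> bool" where
  "psi s t rel x \<longleftrightarrow> cmp_zero (s \<bullet> x + t) rel"

definition II0 :: "nat \<Rightarrow> ('\<nu>, 'm, 'a::linordered_field) lasso_nf \<Rightarrow> 'l set \<Rightarrow>
    ('l \<Rightarrow> strictness) \<Rightarrow> ('l \<Rightarrow> 'a vec) \<Rightarrow> ('l \<Rightarrow> 'a) \<Rightarrow> bool" where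
  "II0 n P L rel s t \<longleftrightarrow>
     (\<forall>l\<in>L. \<forall>x\<in>carrier_vec n. x \<in> stem_of n P \<longrightarrow> psi (s l) (t l) (rel l) x)"

definition IC0 :: "nat \<Rightarrow> ('\<nu>, 'm, 'a::linordered_field) lasso_nf \<Rightarrow> 'l set \<Rightarrow>
    ('l \<Rightarrow> strictness) \<Rightarrow> ('l \<Rightarrow> 'a vec) \<Rightarrow> ('l \<Rightarrow> 'a) \<Rightarrow> bool" where
  "IC0 n P L rel s t \<longleftrightarrow>
     (\<forall>l\<in>L. \<forall>x\<in>carrier_vec n. \<forall>x'\<in>carrier_vec n.
        psi (s l) (t l) (rel l) x \<and> (x, x') \<in> loop_of n P \<longrightarrow> psi (s l) (t l) (rel l) x')"

definition TI0 :: "nat \<Rightarrow> ('\<nu>, 'm, 'a::linordered_field) lasso_nf \<Rightarrow>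
    ('f, 'd, 'i, 'j, 'a) cnf_template \<Rightarrow> 'l set \<Rightarrow> ('l \<Rightarrow> strictness) \<Rightarrow>
    ('l \<Rightarrow> 'a vec) \<Rightarrow> ('l \<Rightarrow> 'a) \<Rightarrow> ('f, 'd, 'a) assignment \<Rightarrow> bool" where
  "TI0 n P T L rel s t v \<longleftrightarrow>
     (\<forall>x\<in>carrier_vec n. \<forall>x'\<in>carrier_vec n.
        (x, x') \<in> loop_of n P \<and> (\<forall>l\<in>L. psi (s l) (t l) (rel l) x) \<longrightarrow> template_holds T v x x')"

definition original_satisfiable :: "nat \<Rightarrow> ('\<nu>, 'm, 'a::linordered_field) lasso_nf \<Rightarrow>
    ('f, 'd, 'i, 'j, 'a) cnf_template \<Rightarrow> 'l set \<Rightarrow> ('l \<Rightarrow> strictness) \<Rightarrow> bool" where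
  "original_satisfiable n P T L rel \<longleftrightarrow>
     (\<exists>s t v. (\<forall>l\<in>L. s l \<in> carrier_vec n) \<and> v \<in> assignments n T \<and>
        II0 n P L rel s t \<and> IC0 n P L rel s t \<and> TI0 n P T L rel s t v)"


subsection \<open>The Motzkin transform\<close>

text \<open>The inequality \<open>lhs\<^sup>T z \<le> rhs\<close>, or \<open>lhs\<^sup>T z < rhs\<close> if \<open>is_strict\<close>.\<close>

datatype 'a ineq = Ineq (is_strict: bool) (lhs: "'a vec") (rhs: 'a)

text \<open>The transform of \<open>\<forall>z. \<not> (\<forall>k\<in>R. c k)\<close> with \<open>z\<close> ranging over vectors of dimension \<open>d\<close>.\<close>

definition motzkin :: "nat \<Rightarrow> 'k set \<Rightarrow> ('k \<Rightarrow> 'a::linordered_field ineq) \<Rightarrow> bool" where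
  "motzkin d R c \<longleftrightarrow>
     (\<exists>\<kappa>. (\<forall>k\<in>R. \<kappa> k \<ge> 0) \<and>
        finsum_vec TYPE('a) d (\<lambda>k. \<kappa> k \<cdot>\<^sub>v lhs (c k)) R = 0\<^sub>v d \<and>
        (\<Sum>k\<in>R. \<kappa> k * rhs (c k)) \<le> 0 \<and>
        ((\<Sum>k\<in>{k \<in> R. \<not> is_strict (c k)}. \<kappa> k * rhs (c k)) < 0 \<or>
         (\<Sum>k\<in>{k \<in> R. is_strict (c k)}. \<kappa> k) > 0))"

text \<open>Each negated conjunction to be transformed consists of the rows of a \<^typ>\<open>'a lin_conj\<close> and
  some further inequalities indexed by a set \<open>X\<close>.\<close>

datatype 'x conjunct = Weak_Row nat | Strict_Row nat | Extra 'x

definition conjuncts :: "'a lin_conj \<Rightarrow> 'x set \<Rightarrow> 'x conjunct set" where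
  "conjuncts C X =
     Weak_Row ` {..<dim_vec (weak_rhs C)} \<union> Strict_Row ` {..<dim_vec (strict_rhs C)} \<union> Extra ` X"

primrec conjunct_ineq :: "'a lin_conj \<Rightarrow> ('x \<Rightarrow> 'a ineq) \<Rightarrow> 'x conjunct \<Rightarrow> 'a ineq" where
  "conjunct_ineq C ex (Weak_Row r) = Ineq False (row (weak_mat C) r) (weak_rhs C $ r)"
| "conjunct_ineq C ex (Strict_Row r) = Ineq True (row (strict_mat C) r) (strict_rhs C $ r)"
| "conjunct_ineq C ex (Extra x) = ex x"

definition motzkin_conj ::
  "nat \<Rightarrow> 'a::linordered_field lin_conj \<Rightarrow> 'x set \<Rightarrow> ('x \<Rightarrow> 'a ineq) \<Rightarrow> bool" where
  "motzkin_conj d C X ex \<longleftrightarrow> motzkin d (conjuncts C X) (conjunct_ineq C ex)"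


subsection \<open>The transformed constraint\<close>

text \<open>\<open>s\<^sup>T z + t \<rhd> 0\<close> becomes \<open>(- s)\<^sup>T z \<le> t\<close> or \<open>(- s)\<^sup>T z < t\<close>, and its negation
  becomes \<open>s\<^sup>T z < - t\<close> or \<open>s\<^sup>T z \<le> - t\<close>.\<close>

definition psi_ineq :: "'a::linordered_field vec \<Rightarrow> 'a \<Rightarrow> strictness \<Rightarrow> 'a ineq" where
  "psi_ineq s t rel = Ineq (rel = GT) (- s) t"

definition neg_psi_ineq :: "'a::linordered_field vec \<Rightarrow> 'a \<Rightarrow> strictness \<Rightarrow> 'a ineq" where
  "neg_psi_ineq s t rel = Ineq (rel = GE) s (- t)"

definition neg_atom_ineq ::
  "nat \<Rightarrow> ('f, 'd, 'i, 'j, 'a::linordered_field) cnf_template \<Rightarrow> ('f, 'd, 'a) assignment \<Rightarrow>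
     ('f, 'd, 'a) atom \<Rightarrow> 'a ineq" where
  "neg_atom_ineq n T v g = Ineq (atom_rel g = GE) (atom_vec n T v g) (atom_scalar T v g)"

definition II5 :: "nat \<Rightarrow> ('\<nu>, 'm, 'a::linordered_field) lasso_nf \<Rightarrow>
    ('f, 'd, 'i, 'j, 'a) cnf_template \<Rightarrow> 'l set \<Rightarrow> ('l \<Rightarrow> strictness) \<Rightarrow>
    ('l \<times> 'i \<times> 'm \<Rightarrow> 'a vec) \<Rightarrow> ('l \<times> 'i \<times> 'm \<Rightarrow> 'a) \<Rightarrow> bool" where
  "II5 n P T L rel s t \<longleftrightarrow>
     (\<forall>l'\<in>L \<times> clauses T \<times> loop_index P. \<forall>\<nu>\<in>stem_index P.
        motzkin_conj n (stem_conj P \<nu>) {()} (\<lambda>_. neg_psi_ineq (s l') (t l') (rel (fst l'))))"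

text \<open>In the variables \<open>z = (x; x')\<close>, \<open>\<psi>(x)\<close> has coefficient vector \<open>(s; 0)\<close> and
  \<open>\<psi>(x')\<close> has \<open>(0; s)\<close>. The two extra conjuncts are indexed by \<^typ>\<open>bool\<close>:
  \<^const>\<open>True\<close> for \<open>\<psi>(x)\<close> and \<^const>\<open>False\<close> for \<open>\<not> \<psi>(x')\<close>.\<close>

definition IC5 :: "nat \<Rightarrow> ('\<nu>, 'm, 'a::linordered_field) lasso_nf \<Rightarrow>
    ('f, 'd, 'i, 'j, 'a) cnf_template \<Rightarrow> 'l set \<Rightarrow> ('l \<Rightarrow> strictness) \<Rightarrow>
    ('l \<times> 'i \<times> 'm \<Rightarrow> 'a vec) \<Rightarrow> ('l \<times> 'i \<times> 'm \<Rightarrow> 'a) \<Rightarrow> bool" where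
  "IC5 n P T L rel s t \<longleftrightarrow>
     (\<forall>l'\<in>L \<times> clauses T \<times> loop_index P. \<forall>m\<in>loop_index P.
        motzkin_conj (n + n) (loop_conj P m) (UNIV :: bool set)
          (\<lambda>pre. if pre then psi_ineq (s l' @\<^sub>v 0\<^sub>v n) (t l') (rel (fst l'))
                 else neg_psi_ineq (0\<^sub>v n @\<^sub>v s l') (t l') (rel (fst l'))))"

definition TI5 :: "nat \<Rightarrow> ('\<nu>, 'm, 'a::linordered_field) lasso_nf \<Rightarrow>
    ('f, 'd, 'i, 'j, 'a) cnf_template \<Rightarrow> 'l set \<Rightarrow> ('l \<Rightarrow> strictness) \<Rightarrow>
    ('l \<times> 'i \<times> 'm \<Rightarrow> 'a vec) \<Rightarrow> ('l \<times> 'i \<times> 'm \<Rightarrow> 'a) \<Rightarrow>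
    ('f, 'd, 'a) assignment \<Rightarrow> bool" where
  "TI5 n P T L rel s t v \<longleftrightarrow>
     (\<forall>i\<in>clauses T. \<forall>m\<in>loop_index P.
        motzkin_conj (n + n) (loop_conj P m) (L <+> disjuncts T i)
          (case_sum
             (\<lambda>l. psi_ineq (s (l, i, m) @\<^sub>v 0\<^sub>v n) (t (l, i, m)) (rel l))
             (\<lambda>j. neg_atom_ineq n T v (atom_at T i j))))"

definition transformed_satisfiable :: "nat \<Rightarrow> ('\<nu>, 'm, 'a::linordered_field) lasso_nf \<Rightarrow>
    ('f, 'd, 'i, 'j, 'a) cnf_template \<Rightarrow> 'l set \<Rightarrow> ('l \<Rightarrow> strictness) \<Rightarrow> bool" where
  "transformed_satisfiable n P T L rel \<longleftrightarrow>
     (\<exists>s t v. (\<forall>l'\<in>L \<times> clauses T \<times> loop_index P. s l' \<in> carrier_vec n) \<and>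
        v \<in> assignments n T \<and>
        II5 n P T L rel s t \<and> IC5 n P T L rel s t \<and> TI5 n P T L rel s t v)"

end

theory Submission
  imports Defs
begin

text \<open>Every \<open>\<psi>\<^bsub>(l,i,m)\<^esub>\<close> is instantiated by \<open>\<psi>\<^sub>l\<close>, so that each negated
  conjunction of the transformed constraint is unsatisfiable. Motzkin's transposition theorem then
  supplies the multipliers. It holds over every ordered field, because Fourier-Motzkin elimination
  of the variables only forms nonnegative combinations of the given inequalities.\<close>

section \<open>Fourier-Motzkin elimination over an ordered field\<close>

definition ineq_holds :: "'a::linordered_field ineq \<Rightarrow> 'a vec \<Rightarrow> bool" where
  "ineq_holds I z \<longleftrightarrow> (if is_strict I then lhs I \<bullet> z < rhs I else lhs I \<bullet> z \<le> rhs I)"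

text \<open>For positive \<open>a\<close> and \<open>b\<close> this is a consequence of
  \<open>I\<close> and \<open>J\<close>. A zero multiplier would make the strictness flag too
  strong, which is why combinations are only ever formed with positive weights.\<close>

definition ineq_comb :: "'a::linordered_field \<Rightarrow> 'a ineq \<Rightarrow> 'a \<Rightarrow> 'a ineq \<Rightarrow> 'a ineq" where
  "ineq_comb a I b J =
     Ineq (is_strict I \<or> is_strict J) (a \<cdot>\<^sub>v lhs I + b \<cdot>\<^sub>v lhs J) (a * rhs I + b * rhs J)"

text \<open>Only the largest lower bound and the smallest upper bound matter. If there is a gap
  between them, density of the field gives a point inside it. If they coincide, their common value
  works, because \<open>pairs\<close> excludes a strict bound that is tight there.\<close>

lemma exists_between_bounds:
  fixes l :: "'b \<Rightarrow> 'a::linordered_field" and u :: "'c \<Rightarrow> 'a"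
  assumes fin: "finite A" "finite B"
    and pairs: "\<And>a b. a \<in> A \<Longrightarrow> b \<in> B \<Longrightarrow> if sl a \<or> su b then l a < u b else l a \<le> u b"
  shows "\<exists>x. (\<forall>a\<in>A. if sl a then l a < x else l a \<le> x) \<and>
             (\<forall>b\<in>B. if su b then x < u b else x \<le> u b)"
proof -
  consider "A = {}" "B = {}" | "A = {}" "B \<noteq> {}" | "A \<noteq> {}" "B = {}" | "A \<noteq> {}" "B \<noteq> {}"
    by blast
  then show ?thesis
  proof cases
    case 1
    then show ?thesis by simp
  next
    case 2
    have "Min (u ` B) - 1 < u b" if "b \<in> B" for b
    proof -
      have "Min (u ` B) \<le> u b" using fin that by simp
      then show ?thesis by (simp add: less_le_trans[of _ "Min (u ` B)"])
    qed
    with 2 show ?thesis by (intro exI[of _ "Min (u ` B) - 1"]) (auto intro: less_imp_le)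
  next
    case 3
    have "l a < Max (l ` A) + 1" if "a \<in> A" for a
    proof -
      have "l a \<le> Max (l ` A)" using fin that by simp
      then show ?thesis by (simp add: le_less_trans[of _ "Max (l ` A)"])
    qed
    with 3 show ?thesis by (intro exI[of _ "Max (l ` A) + 1"]) (auto intro: less_imp_le)
  next
    case 4
    have "Max (l ` A) \<in> l ` A" "Min (u ` B) \<in> u ` B"
      using 4 fin by simp_all
    then obtain a b where a: "a \<in> A" "l a = Max (l ` A)" and b: "b \<in> B" "u b = Min (u ` B)"
      by (metis image_iff)
    have a_max: "\<And>a'. a' \<in> A \<Longrightarrow> l a' \<le> l a" and b_min: "\<And>b'. b' \<in> B \<Longrightarrow> u b \<le> u b'"
      using a(2) b(2) fin by simp_all
    have le: "l a \<le> u b"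
      using pairs[OF a(1) b(1)] by (auto split: if_splits)
    show ?thesis
    proof (cases "l a < u b")
      case True
      then obtain x where x: "l a < x" "x < u b"
        using dense by blast
      have "l a' < x" if "a' \<in> A" for a'
        using a_max[OF that] x(1) by simp
      moreover have "x < u b'" if "b' \<in> B" for b'
        using b_min[OF that] x(2) by simp
      ultimately show ?thesis
        by (intro exI[of _ x]) (auto intro: less_imp_le)
    next
      case False
      with le have eq: "l a = u b" by simp
      have "if sl a' then l a' < l a else l a' \<le> l a" if "a' \<in> A" for a'
        using pairs[OF that b(1)] eq by (auto split: if_splits)
      moreover have "if su b' then l a < u b' else l a \<le> u b'" if "b' \<in> B" for b'
        using pairs[OF a(1) that] by (auto split: if_splits)
      ultimately show ?thesis by blast
    qed
  qed
qed

text \<open>The two differences agree up to the positive factor \<open>p * - q\<close>. In the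
  elimination step, the quotients are the lower and upper bounds that two inequalities with
  coefficients \<open>q\<close> and \<open>p\<close> put on the eliminated variable; comparing these
  bounds is then the same as satisfying the combination with weights \<open>- q\<close> and
  \<open>p\<close>.\<close>

lemma cross_bounds_iff:
  fixes p q r r' y y' :: "'a::linordered_field"
  assumes "p > 0" "q < 0"
  shows "(r' - y') / q \<le> (r - y) / p \<longleftrightarrow> - q * y + p * y' \<le> - q * r + p * r'"
    and "(r' - y') / q < (r - y) / p \<longleftrightarrow> - q * y + p * y' < - q * r + p * r'"
proof -
  have "(r - y) / p - (r' - y') / q = (- q * r + p * r' - (- q * y + p * y')) / (p * - q)"
    using assms by (simp add: divide_simps) (simp add: algebra_simps)
  moreover have "p * - q > 0"
    using assms by (intro mult_pos_pos) auto
  ultimately have "0 \<le> (r - y) / p - (r' - y') / q \<longleftrightarrow> 0 \<le> - q * r + p * r' - (- q * y + p * y')"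
    and "0 < (r - y) / p - (r' - y') / q \<longleftrightarrow> 0 < - q * r + p * r' - (- q * y + p * y')"
    by (simp_all only: pos_le_divide_eq pos_less_divide_eq mult_zero_left)
  then show "(r' - y') / q \<le> (r - y) / p \<longleftrightarrow> - q * y + p * y' \<le> - q * r + p * r'"
    and "(r' - y') / q < (r - y) / p \<longleftrightarrow> - q * y + p * y' < - q * r + p * r'"
    by (simp_all only: diff_ge_0_iff_ge diff_gt_0_iff_gt)
qed

text \<open>Elimination replaces \<open>S\<close> by systems in fewer variables that remain
  unsatisfiable, until an inequality without variables is violated. The family \<open>C\<close> is
  kept abstract: closure under positive combinations is all that elimination needs, so no
  multipliers have to be tracked here.\<close>

lemma fourier_motzkin:
  fixes C S :: "'a::linordered_field ineq set"
  assumes carrier: "\<And>I. I \<in> C \<Longrightarrow> lhs I \<in> carrier_vec d"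
    and comb: "\<And>I J a b. I \<in> C \<Longrightarrow> J \<in> C \<Longrightarrow> a > 0 \<Longrightarrow> b > 0 \<Longrightarrow> ineq_comb a I b J \<in> C"
    and "finite S" "S \<subseteq> C"
    and "\<And>z. z \<in> carrier_vec d \<Longrightarrow> \<exists>I\<in>S. \<not> ineq_holds I z"
  shows "\<exists>I\<in>C. lhs I = 0\<^sub>v d \<and> \<not> ineq_holds I (0\<^sub>v d)"
proof -
  \<comment> \<open>Generalised for induction on \<open>m\<close>: coefficients may be nonzero only
    at indices below \<open>m\<close>. Each step eliminates the variable with the highest remaining
    index.\<close>
  have "\<exists>I\<in>C. lhs I = 0\<^sub>v d \<and> \<not> ineq_holds I (0\<^sub>v d)"
    if "m \<le> d" "finite S" "S \<subseteq> C"
      "\<And>I i. I \<in> S \<Longrightarrow> m \<le> i \<Longrightarrow> i < d \<Longrightarrow> lhs I $ i = 0"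
      "\<And>z. z \<in> carrier_vec d \<Longrightarrow> \<exists>I\<in>S. \<not> ineq_holds I z" for m S
    using that
  proof (induction m arbitrary: S)
    case 0
    \<comment> \<open>No variables are left, so any point would do; the origin exhibits the violated
      inequality.\<close>
    obtain I where I: "I \<in> S" "\<not> ineq_holds I (0\<^sub>v d)"
      using "0.prems"(5)[OF zero_carrier_vec] by blast
    moreover have "lhs I = 0\<^sub>v d"
      using carrier[of I] I(1) "0.prems"(3,4) by (intro eq_vecI) auto
    ultimately show ?case using "0.prems"(3) by blast
  next
    case (Suc m)
    then have m: "m < d" by simp
    define Z where "Z = {I \<in> S. lhs I $ m = 0}"
    define U where "U = {I \<in> S. lhs I $ m > 0}"
    define D where "D = {I \<in> S. lhs I $ m < 0}"
    \<comment> \<open>The weights are positive on \<open>U\<close> and \<open>D\<close>, and they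
      cancel the coefficient at index \<open>m\<close>.\<close>
    define cross where "cross = (\<lambda>(I :: 'a ineq, J). ineq_comb (- (lhs J $ m)) I (lhs I $ m) J)"
    define S' where "S' = Z \<union> cross ` (U \<times> D)"
    have fin: "finite Z" "finite U" "finite D"
      using Suc.prems(2) by (auto simp: Z_def U_def D_def)
    have dims: "dim_vec (lhs I) = d" if "I \<in> S" for I
      using carrier[of I] that Suc.prems(3) by auto
    show ?case
    proof (rule Suc.IH[of S'])
      show "m \<le> d" using m by simp
      show "finite S'" using fin by (simp add: S'_def)
      show "S' \<subseteq> C"
        using Suc.prems(3) by (auto simp: S'_def Z_def U_def D_def cross_def intro!: comb)
    next
      fix I i assume I: "I \<in> S'" and i: "m \<le> i" "i < d"
      show "lhs I $ i = 0"
      proof (cases "I \<in> Z")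
        case True
        then show ?thesis
          using Suc.prems(4)[of I i] i by (cases "i = m") (auto simp: Z_def)
      next
        case False
        then obtain J K where JK: "J \<in> U" "K \<in> D" "I = cross (J, K)"
          using I by (auto simp: S'_def)
        then have "J \<in> S" "K \<in> S" by (auto simp: U_def D_def)
        then show ?thesis
          using Suc.prems(4)[of J i] Suc.prems(4)[of K i] i JK(3) dims[of J] dims[of K]
          by (cases "i = m") (auto simp: cross_def ineq_comb_def)
      qed
    next
      fix z :: "'a vec" assume z: "z \<in> carrier_vec d"
      show "\<exists>I\<in>S'. \<not> ineq_holds I z"
      proof (rule ccontr)
        assume "\<not> (\<exists>I\<in>S'. \<not> ineq_holds I z)"
        then have sat: "\<And>I. I \<in> S' \<Longrightarrow> ineq_holds I z" by blast
        \<comment> \<open>\<open>g I\<close> bounds the shift of \<open>z\<close> along coordinate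
          \<open>m\<close>, not the coordinate itself, since \<open>lhs I \<bullet> z\<close>
          already includes the current value. It is an upper bound on \<open>U\<close> and a lower
          bound on \<open>D\<close>.\<close>
        define g where "g I = (rhs I - lhs I \<bullet> z) / lhs I $ m" for I
        have "if is_strict J \<or> is_strict I then g J < g I else g J \<le> g I"
          if "J \<in> D" "I \<in> U" for I J
        proof -
          have IJ: "lhs I \<in> carrier_vec d" "lhs J \<in> carrier_vec d" "lhs I $ m > 0" "lhs J $ m < 0"
            using that carrier Suc.prems(3) by (auto simp: D_def U_def)
          have "ineq_holds (cross (I, J)) z"
            using that by (intro sat) (auto simp: S'_def)
          then show ?thesis
            unfolding g_def cross_bounds_iff[OF IJ(3,4)] using IJ(1,2) z
            by (auto simp: ineq_holds_def cross_def ineq_comb_def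
                add_scalar_prod_distrib[where n = d] split: if_splits)
        qed
        from exists_between_bounds[OF fin(3,2), of is_strict is_strict g g, OF this]
        obtain x where lower: "\<And>J. J \<in> D \<Longrightarrow> if is_strict J then g J < x else g J \<le> x"
          and upper: "\<And>I. I \<in> U \<Longrightarrow> if is_strict I then x < g I else x \<le> g I"
          by blast
        \<comment> \<open>The shifted point satisfies all of \<open>S\<close>, against the
          assumption: inequalities in \<open>Z\<close> do not notice the shift, and those in
          \<open>U\<close> and \<open>D\<close> hold by the choice of \<open>x\<close>.\<close>
        define z' where "z' = z + x \<cdot>\<^sub>v unit_vec d m"
        have "z' \<in> carrier_vec d" using z by (simp add: z'_def)
        then obtain I where I: "I \<in> S" "\<not> ineq_holds I z'"
          using Suc.prems(5) by blast
        have "lhs I \<in> carrier_vec d" using carrier I(1) Suc.prems(3) by blast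
        then have shift: "lhs I \<bullet> z' = lhs I \<bullet> z + x * lhs I $ m"
          using z m by (simp add: z'_def scalar_prod_add_distrib[where n = d])
        consider "I \<in> Z" | "I \<in> U" | "I \<in> D"
          using I(1) linorder_less_linear[of "lhs I $ m" 0] by (auto simp: Z_def U_def D_def)
        then have "ineq_holds I z'"
        proof cases
          case 1
          then show ?thesis
            using sat[of I] shift by (auto simp: S'_def Z_def ineq_holds_def)
        next
          case 2
          then show ?thesis
            using upper[OF 2] shift
            by (auto simp: U_def ineq_holds_def g_def pos_le_divide_eq pos_less_divide_eq
                algebra_simps split: if_splits)
        next
          case 3
          then show ?thesis
            using lower[OF 3] shift
            by (auto simp: D_def ineq_holds_def g_def neg_divide_le_eq neg_divide_less_eq
                algebra_simps split: if_splits)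
        qed
        with I(2) show False ..
      qed
    qed
  qed
  \<comment> \<open>At \<open>m = d\<close> the condition on vanishing coefficients is
    vacuous.\<close>
  from this[of d S] assms(3-5) show ?thesis by auto
qed

section \<open>Motzkin's transposition theorem\<close>

text \<open>Elimination is applied with \<open>C\<close> taken as the set of all nonnegative
  combinations of the given inequalities. The contradictory inequality it finds then carries its
  multipliers, and these are the required certificate.\<close>

theorem motzkin_transposition:
  fixes c :: "'k \<Rightarrow> 'a::linordered_field ineq"
  assumes fin: "finite R"
    and carrier: "\<And>k. k \<in> R \<Longrightarrow> lhs (c k) \<in> carrier_vec d"
    and unsat: "\<And>z. z \<in> carrier_vec d \<Longrightarrow> \<exists>k\<in>R. \<not> ineq_holds (c k) z"
  shows "motzkin d R c"
proof -
  \<comment> \<open>A combination counts as strict only if some strict inequality enters with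
    positive weight. The left-hand side is written coordinatewise and identified with
    \<open>finsum_vec\<close> at the end.\<close>
  define comb where "comb \<kappa> =
    Ineq (\<exists>k\<in>R. is_strict (c k) \<and> \<kappa> k > 0) (vec d (\<lambda>i. \<Sum>k\<in>R. \<kappa> k * lhs (c k) $ i))
      (\<Sum>k\<in>R. \<kappa> k * rhs (c k))" for \<kappa>
  define C where "C = comb ` {\<kappa>. \<forall>k\<in>R. \<kappa> k \<ge> 0}"
  have single: "c k = comb (\<lambda>k'. if k' = k then 1 else 0)" if "k \<in> R" for k
  proof (rule ineq.expand, intro conjI)
    show "lhs (c k) = lhs (comb (\<lambda>k'. if k' = k then 1 else 0))"
      using that carrier[OF that] fin
      by (intro eq_vecI) (auto simp: comb_def if_distrib[of "\<lambda>y. y * _"] cong: if_cong)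
  qed (use that fin in \<open>auto simp: comb_def if_distrib[of "\<lambda>y. y * _"] cong: if_cong\<close>)
  have "\<exists>I\<in>C. lhs I = 0\<^sub>v d \<and> \<not> ineq_holds I (0\<^sub>v d)"
  proof (rule fourier_motzkin[where S = "c ` R"])
    show "lhs I \<in> carrier_vec d" if "I \<in> C" for I
      using that by (auto simp: C_def comb_def)
  next
    fix I J :: "'a ineq" and a b :: 'a
    assume "I \<in> C" "J \<in> C" and ab: "a > 0" "b > 0"
    then obtain \<kappa> \<mu> where IJ: "I = comb \<kappa>" "J = comb \<mu>"
      and nonneg: "\<forall>k\<in>R. \<kappa> k \<ge> 0" "\<forall>k\<in>R. \<mu> k \<ge> 0"
      by (auto simp: C_def)
    \<comment> \<open>This makes the strictness flags agree: terms that are nonnegative cannot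
      cancel, so a strict inequality enters the sum exactly when it enters one of the
      summands.\<close>
    have pos: "a * \<kappa> k + b * \<mu> k > 0 \<longleftrightarrow> \<kappa> k > 0 \<or> \<mu> k > 0" if "k \<in> R" for k
    proof -
      have "0 \<le> a * \<kappa> k" "0 \<le> b * \<mu> k" using nonneg that ab by auto
      moreover have "0 < a * \<kappa> k \<longleftrightarrow> 0 < \<kappa> k" "0 < b * \<mu> k \<longleftrightarrow> 0 < \<mu> k"
        using ab by (auto simp: zero_less_mult_iff)
      ultimately show ?thesis by linarith
    qed
    have "ineq_comb a I b J = comb (\<lambda>k. a * \<kappa> k + b * \<mu> k)"
    proof (rule ineq.expand, intro conjI)
      show "is_strict (ineq_comb a I b J) = is_strict (comb (\<lambda>k. a * \<kappa> k + b * \<mu> k))"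
        using pos by (auto simp: IJ comb_def ineq_comb_def)
      show "lhs (ineq_comb a I b J) = lhs (comb (\<lambda>k. a * \<kappa> k + b * \<mu> k))"
        by (intro eq_vecI)
          (auto simp: IJ comb_def ineq_comb_def sum_distrib_left sum.distrib algebra_simps)
      show "rhs (ineq_comb a I b J) = rhs (comb (\<lambda>k. a * \<kappa> k + b * \<mu> k))"
        by (auto simp: IJ comb_def ineq_comb_def sum_distrib_left sum.distrib algebra_simps)
    qed
    moreover have "\<forall>k\<in>R. a * \<kappa> k + b * \<mu> k \<ge> 0" using nonneg ab by simp
    ultimately show "ineq_comb a I b J \<in> C" by (simp add: C_def)
  next
    show "finite (c ` R)" using fin by simp
    show "c ` R \<subseteq> C"
      using single by (fastforce simp: C_def)
    show "\<exists>I\<in>c ` R. \<not> ineq_holds I z" if "z \<in> carrier_vec d" for z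
      using unsat[OF that] by blast
  qed
  then obtain \<kappa> where nonneg: "\<And>k. k \<in> R \<Longrightarrow> \<kappa> k \<ge> 0"
    and lhs0: "lhs (comb \<kappa>) = 0\<^sub>v d" and viol: "\<not> ineq_holds (comb \<kappa>) (0\<^sub>v d)"
    by (auto simp: C_def)
  have vs: "(\<lambda>k. \<kappa> k \<cdot>\<^sub>v lhs (c k)) \<in> R \<rightarrow> carrier_vec d"
    using carrier by auto
  have "finsum_vec TYPE('a) d (\<lambda>k. \<kappa> k \<cdot>\<^sub>v lhs (c k)) R = lhs (comb \<kappa>)"
  proof (rule eq_vecI)
    show "dim_vec (finsum_vec TYPE('a) d (\<lambda>k. \<kappa> k \<cdot>\<^sub>v lhs (c k)) R) = dim_vec (lhs (comb \<kappa>))"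
      using finsum_vec_closed[OF vs] by (auto simp: comb_def)
    fix i assume "i < dim_vec (lhs (comb \<kappa>))"
    then have i: "i < d" by (simp add: comb_def)
    have "(\<kappa> k \<cdot>\<^sub>v lhs (c k)) $ i = \<kappa> k * lhs (c k) $ i" if "k \<in> R" for k
      using carrier[OF that] i by simp
    then show "finsum_vec TYPE('a) d (\<lambda>k. \<kappa> k \<cdot>\<^sub>v lhs (c k)) R $ i = lhs (comb \<kappa>) $ i"
      using i by (simp add: index_finsum_vec[OF fin i vs] comb_def)
  qed
  then have zero: "finsum_vec TYPE('a) d (\<lambda>k. \<kappa> k \<cdot>\<^sub>v lhs (c k)) R = 0\<^sub>v d"
    using lhs0 by simp
  \<comment> \<open>With zero left-hand side, violation is a condition on the sign of the right-hand
    side alone.\<close>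
  have rhs_viol: "if is_strict (comb \<kappa>) then rhs (comb \<kappa>) \<le> 0 else rhs (comb \<kappa>) < 0"
    using viol by (auto simp: ineq_holds_def lhs0)
  have le: "(\<Sum>k\<in>R. \<kappa> k * rhs (c k)) \<le> 0"
    using rhs_viol by (auto simp: comb_def split: if_splits)
  have "(\<Sum>k\<in>{k \<in> R. \<not> is_strict (c k)}. \<kappa> k * rhs (c k)) < 0 \<or>
    (\<Sum>k\<in>{k \<in> R. is_strict (c k)}. \<kappa> k) > 0"
  \<comment> \<open>The two disjuncts of the transform correspond to a strict and a weak
    contradictory combination. In the weak case all weights of strict inequalities vanish, so the
    sum over the weak ones is already the full sum.\<close>
  proof (cases "\<exists>k\<in>R. is_strict (c k) \<and> \<kappa> k > 0")
    case True
    then obtain k where k: "k \<in> R" "is_strict (c k)" "\<kappa> k > 0" by blast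
    then have "(\<Sum>k\<in>{k \<in> R. is_strict (c k)}. \<kappa> k) > 0"
      using fin nonneg by (intro sum_pos2[of _ k]) auto
    then show ?thesis ..
  next
    case False
    then have "(\<Sum>k\<in>R. \<kappa> k * rhs (c k)) < 0"
      using rhs_viol by (auto simp: comb_def split: if_splits)
    moreover have "(\<Sum>k\<in>{k \<in> R. \<not> is_strict (c k)}. \<kappa> k * rhs (c k)) = (\<Sum>k\<in>R. \<kappa> k * rhs (c k))"
      using fin False nonneg by (intro sum.mono_neutral_left) (auto simp: order_le_less)
    ultimately show ?thesis by simp
  qed
  with nonneg zero le show ?thesis
    unfolding motzkin_def by blast
qed

text \<open>Interface used for all three constraints: the matrix rows are absorbed into
  \<open>conj_holds\<close>, which leaves only the task of violating one of the extra
  inequalities.\<close>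

lemma motzkin_conj_if_unsat:
  assumes wf: "wf_conj d C" and fin: "finite X"
    and carrier: "\<And>x. x \<in> X \<Longrightarrow> lhs (ex x) \<in> carrier_vec d"
    and unsat: "\<And>z. z \<in> carrier_vec d \<Longrightarrow> conj_holds C z \<Longrightarrow> \<exists>x\<in>X. \<not> ineq_holds (ex x) z"
  shows "motzkin_conj d C X ex"
  unfolding motzkin_conj_def
proof (rule motzkin_transposition)
  show "finite (conjuncts C X)"
    using fin by (simp add: conjuncts_def)
  show "lhs (conjunct_ineq C ex k) \<in> carrier_vec d" if "k \<in> conjuncts C X" for k
    using that wf carrier by (auto simp: conjuncts_def wf_conj_def)
next
  fix z :: "'a vec" assume z: "z \<in> carrier_vec d"
  show "\<exists>k\<in>conjuncts C X. \<not> ineq_holds (conjunct_ineq C ex k) z"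
  proof (rule ccontr)
    assume "\<not> ?thesis"
    then have sat: "ineq_holds (conjunct_ineq C ex k) z" if "k \<in> conjuncts C X" for k
      using that by blast
    have "row (weak_mat C) r \<bullet> z \<le> weak_rhs C $ r" if "r < dim_vec (weak_rhs C)" for r
      using sat[of "Weak_Row r"] that by (simp add: conjuncts_def ineq_holds_def)
    moreover have "row (strict_mat C) r \<bullet> z < strict_rhs C $ r" if "r < dim_vec (strict_rhs C)" for r
      using sat[of "Strict_Row r"] that by (simp add: conjuncts_def ineq_holds_def)
    ultimately have "conj_holds C z"
      using wf by (auto simp: conj_holds_def wf_conj_def vec_lt_def less_eq_vec_def)
    then obtain x where "x \<in> X" "\<not> ineq_holds (ex x) z"
      using unsat[OF z] by blast
    with sat[of "Extra x"] show False
      by (simp add: conjuncts_def)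
  qed
qed

section \<open>Semantics of the collected inequalities for invariants and atoms\<close>

lemma ineq_holds_psi_ineq:
  assumes "s \<in> carrier_vec d" "z \<in> carrier_vec d"
  shows "ineq_holds (psi_ineq s t r) z \<longleftrightarrow> psi s t r z"
  using assms by (cases r) (auto simp: ineq_holds_def psi_ineq_def psi_def)

lemma ineq_holds_neg_psi_ineq: "ineq_holds (neg_psi_ineq s t r) z \<longleftrightarrow> \<not> psi s t r z"
  by (cases r) (auto simp: ineq_holds_def neg_psi_ineq_def psi_def)

lemma psi_append:
  assumes "s \<in> carrier_vec n" "x \<in> carrier_vec n" "x' \<in> carrier_vec n"
  shows "psi (s @\<^sub>v 0\<^sub>v n) t r (x @\<^sub>v x') \<longleftrightarrow> psi s t r x"
    and "psi (0\<^sub>v n @\<^sub>v s) t r (x @\<^sub>v x') \<longleftrightarrow> psi s t r x'"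
  using assms by (simp_all add: psi_def scalar_prod_append[where ?n1.0 = n and ?n2.0 = n])

lemma finsum_vec_scalar_prod:
  fixes w :: "'b \<Rightarrow> 'a::comm_ring_1 vec"
  assumes "finite F" "\<And>f. f \<in> F \<Longrightarrow> w f \<in> carrier_vec n" "x \<in> carrier_vec n"
  shows "finsum_vec TYPE('a) n (\<lambda>f. a f \<cdot>\<^sub>v w f) F \<bullet> x = (\<Sum>f\<in>F. a f * (w f \<bullet> x))"
  using assms(1,2)
proof (induction F)
  case empty
  then show ?case using assms(3) by (simp add: finsum_vec_empty)
next
  case (insert g F)
  have F: "(\<lambda>f. a f \<cdot>\<^sub>v w f) \<in> F \<rightarrow> carrier_vec n" and g: "a g \<cdot>\<^sub>v w g \<in> carrier_vec n"
    using insert.prems by auto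
  show ?case
    using insert assms(3) finsum_vec_closed[OF F]
    by (simp add: finsum_vec_insert[OF insert.hyps F g] add_scalar_prod_distrib[where n = n])
qed

lemma atom_vec_carrier:
  assumes "v \<in> assignments n T"
  shows "atom_vec n T v g \<in> carrier_vec (n + n)"
  unfolding atom_vec_def using assms
  by (intro append_carrier_vec finsum_vec_closed) (auto simp: assignments_def)

text \<open>The equation \<open>diff\<close> shows that collecting terms changes the atom's affine
  expression neither in value nor in scale; negation then just exchanges weak and strict
  comparison.\<close>

lemma ineq_holds_neg_atom_ineq:
  fixes T :: "('f, 'd, 'i, 'j, 'a::linordered_field) cnf_template"
  assumes "wf_template T" and v: "v \<in> assignments n T"
    and x: "x \<in> carrier_vec n" "x' \<in> carrier_vec n"
  shows "ineq_holds (neg_atom_ineq n T v g) (x @\<^sub>v x') \<longleftrightarrow> \<not> atom_holds T v g x x'"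
proof -
  have fin: "finite (fun_syms T)" using assms(1) by (simp add: wf_template_def)
  have lin: "\<And>f. f \<in> fun_syms T \<Longrightarrow> fun_lin v f \<in> carrier_vec n"
    using v by (auto simp: assignments_def)
  have closed: "finsum_vec TYPE('a) n (\<lambda>f. a f \<cdot>\<^sub>v fun_lin v f) (fun_syms T) \<in> carrier_vec n" for a
    using lin by (intro finsum_vec_closed) auto
  have prod: "finsum_vec TYPE('a) n (\<lambda>f. a f \<cdot>\<^sub>v fun_lin v f) (fun_syms T) \<bullet> y =
    (\<Sum>f\<in>fun_syms T. a f * (fun_lin v f \<bullet> y))" if "y \<in> carrier_vec n" for a y
    using finsum_vec_scalar_prod[of "fun_syms T" "fun_lin v"] fin lin that by blast
  have diff: "atom_vec n T v g \<bullet> (x @\<^sub>v x') - atom_scalar T v g =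
    (\<Sum>f\<in>fun_syms T. coeff_pre g f * fun_val v f x + coeff_post g f * fun_val v f x')
      + (\<Sum>d\<in>var_syms T. coeff_var g d * var_val v d)"
    unfolding atom_vec_def atom_scalar_def fun_val_def scalar_prod_append[OF closed closed x]
      prod[OF x(1)] prod[OF x(2)]
    by (simp add: algebra_simps sum.distrib)
  show ?thesis
    unfolding ineq_holds_def neg_atom_ineq_def atom_holds_def diff[symmetric]
    by (cases "atom_rel g") (simp_all add: not_le not_less)
qed

section \<open>From a solution of the original constraint to one of the transformed
  constraint\<close>

theorem theorem5p4:
  fixes n :: nat
    and P :: "('\<nu>, 'm, 'a::linordered_field) lasso_nf"
    and T :: "('f, 'd, 'i, 'j, 'a) cnf_template"
    and L :: "'l set"
    and rel :: "'l \<Rightarrow> strictness"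
  assumes "rational_or_real_closed TYPE('a)"
    and "wf_lasso_nf n P"
    and "linear_ranking_template n T"
    and "finite L"
    and "original_satisfiable n P T L rel"
  shows "transformed_satisfiable n P T L rel"
proof -
  have wfT: "wf_template T"
    using assms(3) by (simp add: linear_ranking_template_def)
  obtain s t v where s: "\<And>l. l \<in> L \<Longrightarrow> s l \<in> carrier_vec n" and v: "v \<in> assignments n T"
    and ii: "II0 n P L rel s t" and ic: "IC0 n P L rel s t" and ti: "TI0 n P T L rel s t v"
    using assms(5) unfolding original_satisfiable_def by blast
  \<comment> \<open>The copies ignore the clause and the loop disjunct: each is the original
    invariant for its first component.\<close>
  define s' where "s' = (\<lambda>l' :: 'l \<times> 'i \<times> 'm. s (fst l'))"
  define t' where "t' = (\<lambda>l' :: 'l \<times> 'i \<times> 'm. t (fst l'))"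
  have "II5 n P T L rel s' t'"
    unfolding II5_def
  proof (intro ballI motzkin_conj_if_unsat)
    fix l' \<nu> and z :: "'a vec"
    assume l': "l' \<in> L \<times> clauses T \<times> loop_index P" and \<nu>: "\<nu> \<in> stem_index P"
    show "wf_conj n (stem_conj P \<nu>)"
      using assms(2) \<nu> by (simp add: wf_lasso_nf_def)
    show "lhs (neg_psi_ineq (s' l') (t' l') (rel (fst l'))) \<in> carrier_vec n"
      using l' s by (auto simp: neg_psi_ineq_def s'_def)
    assume "z \<in> carrier_vec n" "conj_holds (stem_conj P \<nu>) z"
    then have "psi (s' l') (t' l') (rel (fst l')) z"
      using ii l' \<nu> unfolding II0_def stem_of_def s'_def t'_def by fastforce
    then show "\<exists>x\<in>{()}. \<not> ineq_holds (neg_psi_ineq (s' l') (t' l') (rel (fst l'))) z"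
      by (simp add: ineq_holds_neg_psi_ineq)
  qed simp
  moreover have "IC5 n P T L rel s' t'"
    unfolding IC5_def
  proof (intro ballI motzkin_conj_if_unsat)
    fix l' m and z :: "'a vec"
    assume l': "l' \<in> L \<times> clauses T \<times> loop_index P" and m: "m \<in> loop_index P"
    have sl: "s' l' \<in> carrier_vec n" using l' s by (auto simp: s'_def)
    show "wf_conj (n + n) (loop_conj P m)"
      using assms(2) m by (simp add: wf_lasso_nf_def)
    let ?ex = "\<lambda>pre. if pre then psi_ineq (s' l' @\<^sub>v 0\<^sub>v n) (t' l') (rel (fst l'))
                 else neg_psi_ineq (0\<^sub>v n @\<^sub>v s' l') (t' l') (rel (fst l'))"
    show "lhs (?ex pre) \<in> carrier_vec (n + n)" for pre
      using sl by (auto simp: psi_ineq_def neg_psi_ineq_def)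
    assume z: "z \<in> carrier_vec (n + n)" "conj_holds (loop_conj P m) z"
    \<comment> \<open>The transform ranges over one vector of dimension \<open>n + n\<close>,
      whereas \<open>IC0\<close> speaks of a pair of states; the two halves recover that
      pair.\<close>
    define x x' where "x = vec_first z n" and "x' = vec_last z n"
    have xx': "z = x @\<^sub>v x'" "x \<in> carrier_vec n" "x' \<in> carrier_vec n"
      using z(1) by (simp_all add: x_def x'_def)
    have loop: "(x, x') \<in> loop_of n P"
      using m z(2) xx' by (auto simp: loop_of_def)
    have "psi (s' l') (t' l') (rel (fst l')) x \<longrightarrow> psi (s' l') (t' l') (rel (fst l')) x'"
      using ic l' loop xx'(2,3) unfolding IC0_def s'_def t'_def by (metis mem_Times_iff)
    \<comment> \<open>Inductiveness read as a disjunction: either the invariant fails before the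
      step, or its negation fails after it.\<close>
    then have "\<not> ineq_holds (?ex True) z \<or> \<not> ineq_holds (?ex False) z"
      using sl xx' by (simp add: ineq_holds_psi_ineq[where d = "n + n"] ineq_holds_neg_psi_ineq psi_append)
    then show "\<exists>pre\<in>UNIV. \<not> ineq_holds (?ex pre) z" by blast
  qed simp
  moreover have "TI5 n P T L rel s' t' v"
    unfolding TI5_def
  proof (intro ballI motzkin_conj_if_unsat)
    fix i m and z :: "'a vec"
    assume i: "i \<in> clauses T" and m: "m \<in> loop_index P"
    show "wf_conj (n + n) (loop_conj P m)"
      using assms(2) m by (simp add: wf_lasso_nf_def)
    show "finite (L <+> disjuncts T i)"
      using assms(4) wfT i by (auto simp: wf_template_def)
    let ?ex = "case_sum (\<lambda>l. psi_ineq (s' (l, i, m) @\<^sub>v 0\<^sub>v n) (t' (l, i, m)) (rel l))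
      (\<lambda>j. neg_atom_ineq n T v (atom_at T i j))"
    show "lhs (?ex k) \<in> carrier_vec (n + n)" if "k \<in> L <+> disjuncts T i" for k
      using that s atom_vec_carrier[OF v] by (auto simp: psi_ineq_def neg_atom_ineq_def s'_def)
    assume z: "z \<in> carrier_vec (n + n)" "conj_holds (loop_conj P m) z"
    define x x' where "x = vec_first z n" and "x' = vec_last z n"
    have xx': "z = x @\<^sub>v x'" "x \<in> carrier_vec n" "x' \<in> carrier_vec n"
      using z(1) by (simp_all add: x_def x'_def)
    have loop: "(x, x') \<in> loop_of n P"
      using m z(2) xx' by (auto simp: loop_of_def)
    show "\<exists>k\<in>L <+> disjuncts T i. \<not> ineq_holds (?ex k) z"
    \<comment> \<open>If all invariants hold at \<open>x\<close>, then \<open>TI0\<close> makes some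
      disjunct of clause \<open>i\<close> true and so violates its negated atom. Otherwise a failing
      invariant violates its own conjunct.\<close>
    proof (cases "\<forall>l\<in>L. psi (s l) (t l) (rel l) x")
      case True
      then obtain j where j: "j \<in> disjuncts T i" "atom_holds T v (atom_at T i j) x x'"
        using ti loop xx'(2,3) i unfolding TI0_def template_holds_def by blast
      then have "\<not> ineq_holds (?ex (Inr j)) z"
        using xx' by (simp add: ineq_holds_neg_atom_ineq[OF wfT v])
      with j(1) show ?thesis by blast
    next
      case False
      then obtain l where l: "l \<in> L" "\<not> psi (s l) (t l) (rel l) x" by blast
      then have "\<not> ineq_holds (?ex (Inl l)) z"
        using xx' s[OF l(1)]
        by (simp add: ineq_holds_psi_ineq[where d = "n + n"] psi_append s'_def t'_def)
      with l(1) show ?thesis by blast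
    qed
  qed
  moreover have "\<forall>l'\<in>L \<times> clauses T \<times> loop_index P. s' l' \<in> carrier_vec n"
    using s by (auto simp: s'_def)
  ultimately show ?thesis
    unfolding transformed_satisfiable_def using v by blast
qed

end
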